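(* Let $d\ge 2$ be an integer. For each $n\ge1$ let $G_n$ be a $d$-regular digraph on a finite nonempty vertex set $V_n$, with adjacency matrix $A_n$. Let $k\ge 1$ and suppose that for every $j\in\{1,\dots,k\}$, the number $c_j(G_n)$ of plain cycles of length $j$ in $G_n$ satisfies $$\frac{c_j(G_n)}{|V_n|}\xrightarrow[n\to\infty]{}0.$$ Then for every word $w\in\{1,*\}^k$, $$\frac1{|V_n|}\operatorname{Tr}(A_n^w)\xrightarrow[n\to\infty]{}M_d(w),$$ where $M_d(w):=A_d^w(o,o)$ is the $w$-star moment at the root $o$ of the $d$-regular directed tree $T_d$.
   Context: A digraph here is simple: no loops and no multiple arcs (two opposite arcs $(u,v)$ and $(v,u)$ are allowed). It is $d$-regular if every vertex has in-degree $d$ and out-degree $d$. Its adjacency matrix $A$ has $A(u,v)=1$ if $(u,v)$ is an arc and $A(u,v)=0$ otherwise. For a matrix $A$, $A^1:=A$ and $A^*$ is its adjoint (here, its transpose). For a word $w=w_1\cdots w_k$ on $\{1,*\}$, $A^w:=A^{w_1}\cdots A^{w_k}$. Number of plain cycles (cycles made of distinct arcs, disregarding arc orientations). For a digraph $G$ with vertex set $V$ and adjacency matrix $A$, and $j\ge1$, $$c_j(G):=\frac1{2j}\sum_{w\in\{1,*\}^j}\ \sum_{\mathbf v}A^{w_1}(v_0,v_1)\cdots A^{w_j}(v_{j-1},v_j),$$ where the inner sum ranges over all $\mathbf v=(v_0,\dots,v_{j-1},v_j)\in V^{j+1}$ with $v_j=v_0$ such that the sequence $\big((v_{i-1},v_i)^{w_i}\big)_{1\le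 i\le j}$ is injective (its terms are pairwise distinct), with $(v,v')^1:=(v,v')$ and $(v,v')^*:=(v',v)$. The $d$-regular directed tree $T_d$ is the Cayley graph of the free group $F_d=\langle e_1,\dots,e_d\rangle$: vertices are the elements of $F_d$, with arcs $(v,v e_i)$ for $v\in F_d$, $i\in\{1,\dots,d\}$; the root $o$ is the identity element. $A_d$ denotes its (infinite) adjacency matrix, and $$A_d^w(v,v'):=\sum_{\substack{v_0,v_1,\dots,v_k\in T_d\\ v_0=v,\ v_k=v'}}A_d^{w_1}(v_0,v_1)\cdots A_d^{w_k}(v_{k-1},v_k).$$ *)

theory Defs
  imports
    "HOL-Analysis.Analysis"
    "HOL-Algebra.Group"
    "Graph_Theory.Pair_Digraph"
begin

section \<open>Words on the letters 1 and *\<close>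

datatype star_letter = One | Star

text \<open>Matrices indexed by a set \<open>V\<close> of vertices are functions \<open>'a \<Rightarrow> 'a \<Rightarrow> real\<close>, of which
  only the entries in \<open>V \<times> V\<close> matter.\<close>

definition mat_letter :: "('a \<Rightarrow> 'a \<Rightarrow> real) \<Rightarrow> star_letter \<Rightarrow> 'a \<Rightarrow> 'a \<Rightarrow> real" where
  "mat_letter A x u v = (case x of One \<Rightarrow> A u v | Star \<Rightarrow> A v u)"

definition mat_mult_on :: "'a set \<Rightarrow> ('a \<Rightarrow> 'a \<Rightarrow> real) \<Rightarrow> ('a \<Rightarrow> 'a \<Rightarrow> real) \<Rightarrow> 'a \<Rightarrow> 'a \<Rightarrow> real" where
  "mat_mult_on V A B u v = (\<Sum>x\<in>V. A u x * B x v)"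

definition mat_one :: "'a \<Rightarrow> 'a \<Rightarrow> real" where
  "mat_one u v = (if u = v then 1 else 0)"

definition mat_word :: "'a set \<Rightarrow> ('a \<Rightarrow> 'a \<Rightarrow> real) \<Rightarrow> star_letter list \<Rightarrow> 'a \<Rightarrow> 'a \<Rightarrow> real" where
  "mat_word V A w = foldr (\<lambda>x B. mat_mult_on V (mat_letter A x) B) w mat_one"

definition trace_on :: "'a set \<Rightarrow> ('a \<Rightarrow> 'a \<Rightarrow> real) \<Rightarrow> real" where
  "trace_on V A = (\<Sum>v\<in>V. A v v)"

section \<open>Digraphs\<close>

definition regular_digraph :: "nat \<Rightarrow> 'a pair_pre_digraph \<Rightarrow> bool" where
  "regular_digraph d G \<longleftrightarrow> (\<forall>v\<in>pverts G. in_degree G v = d \<and> out_degree G v = d)"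

definition adj_matrix :: "'a pair_pre_digraph \<Rightarrow> 'a \<Rightarrow> 'a \<Rightarrow> real" where
  "adj_matrix G u v = (if (u, v) \<in> parcs G then 1 else 0)"

definition orient :: "star_letter \<Rightarrow> 'a \<times> 'a \<Rightarrow> 'a \<times> 'a" where
  "orient x e = (case x of One \<Rightarrow> e | Star \<Rightarrow> (snd e, fst e))"

text \<open>The product of the entries read along the vertex sequence \<open>vs\<close>, which has one
  entry more than \<open>w\<close>.\<close>

definition path_weight ::
  "'a pair_pre_digraph \<Rightarrow> star_letter list \<Rightarrow> 'a list \<Rightarrow> real" where
  "path_weight G w vs =
     (\<Prod>i<length w. mat_letter (adj_matrix G) (w ! i) (vs ! i) (vs ! Suc i))"

definition plain_cycles :: "nat \<Rightarrow> 'a pair_pre_digraph \<Rightarrow> real" where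
  "plain_cycles j G =
     1 / (2 * real j) *
     (\<Sum>w \<in> {w. length w = j}.
        \<Sum>vs \<in> {vs. length vs = j + 1 \<and> set vs \<subseteq> pverts G \<and> vs ! j = vs ! 0 \<and>
                    inj_on (\<lambda>i. orient (w ! i) (vs ! i, vs ! Suc i)) {..<j}}.
          path_weight G w vs)"

text \<open>Entries of \<open>A\<^sup>w\<close> for a possibly infinite digraph, as a sum over all vertex
  sequences. For a locally finite digraph only finitely many terms are nonzero
  (lemma \<open>finite_path_support\<close>), as is the case for the tree below
  (lemma \<open>regular_tree_locally_finite\<close>), so that \<open>infsum\<close> is a genuine sum.\<close>

definition word_entry ::
  "'a pair_pre_digraph \<Rightarrow> star_letter list \<Rightarrow> 'a \<Rightarrow> 'a \<Rightarrow> real" where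
  "word_entry G w v v' =
     infsum (path_weight G w)
       {vs. length vs = length w + 1 \<and> set vs \<subseteq> pverts G \<and> vs ! 0 = v \<and> vs ! length w = v'}"

lemma finite_star_words: "finite {w :: star_letter list. length w = j}"
proof -
  have "(UNIV :: star_letter set) = {One, Star}"
    using star_letter.exhaust by auto
  then have "finite (UNIV :: star_letter set)"
    by (metis finite.emptyI finite.insertI)
  from finite_lists_length_eq[OF this, of j] show ?thesis
    by simp
qed

lemma finite_path_support:
  assumes "\<And>v. v \<in> pverts G \<Longrightarrow> finite {u. (v, u) \<in> parcs G \<or> (u, v) \<in> parcs G}"
  shows "finite {vs. length vs = length w + 1 \<and> set vs \<subseteq> pverts G \<and> vs ! 0 = v \<and>
                     path_weight G w vs \<noteq> 0}"
proof (induction w arbitrary: v)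
  case Nil
  have "{vs. length vs = length ([] :: star_letter list) + 1 \<and> set vs \<subseteq> pverts G \<and> vs ! 0 = v \<and>
             path_weight G [] vs \<noteq> 0} \<subseteq> {[v]}"
    by (auto simp: length_Suc_conv)
  then show ?case
    using finite_subset by blast
next
  case (Cons x w)
  let ?S = "\<lambda>w v. {vs. length vs = length w + 1 \<and> set vs \<subseteq> pverts G \<and> vs ! 0 = v \<and>
                        path_weight G w vs \<noteq> 0}"
  let ?N = "{u. (v, u) \<in> parcs G \<or> (u, v) \<in> parcs G}"
  show ?case
  proof (cases "v \<in> pverts G")
    case False
    then have "?S (x # w) v = {}"
      by (auto simp: length_Suc_conv)
    then show ?thesis
      by (simp only: finite.emptyI)
  next
    case True
    have "?S (x # w) v \<subseteq> (\<Union>u\<in>?N. (#) v ` ?S w u)"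
    proof
      fix vs assume vs: "vs \<in> ?S (x # w) v"
      then obtain u us where eq: "vs = v # u # us" and len: "length us = length w"
        by (auto simp: length_Suc_conv)
      have "path_weight G (x # w) vs =
              mat_letter (adj_matrix G) x v u * path_weight G w (u # us)"
        unfolding path_weight_def eq by (simp add: prod.lessThan_Suc_shift del: prod.lessThan_Suc)
      then have "mat_letter (adj_matrix G) x v u \<noteq> 0" "path_weight G w (u # us) \<noteq> 0"
        using vs by auto
      then have "u \<in> ?N" "u # us \<in> ?S w u"
        using vs len eq
        by (auto simp: mat_letter_def adj_matrix_def split: star_letter.splits if_splits)
      then show "vs \<in> (\<Union>u\<in>?N. (#) v ` ?S w u)"
        using eq by blast
    qed
    moreover have "finite (\<Union>u\<in>?N. (#) v ` ?S w u)"
      using assms[OF True] Cons.IH by blast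
    ultimately show ?thesis
      using finite_subset by blast
  qed
qed

section \<open>The free group and its Cayley graph\<close>

text \<open>The free group on \<open>e\<^sub>1, \<dots>, e\<^sub>d\<close>, realised by reduced words. The letter
  \<open>(i, True)\<close> stands for the generator \<open>e\<^sub>i\<close> and \<open>(i, False)\<close> for its inverse.\<close>

type_synonym group_letter = "nat \<times> bool"

definition inv_letter :: "group_letter \<Rightarrow> group_letter" where
  "inv_letter x = (fst x, \<not> snd x)"

definition reduced :: "group_letter list \<Rightarrow> bool" where
  "reduced w \<longleftrightarrow> successively (\<lambda>x y. y \<noteq> inv_letter x) w"

fun reduced_Cons :: "group_letter \<Rightarrow> group_letter list \<Rightarrow> group_letter list" where
  "reduced_Cons x [] = [x]"
| "reduced_Cons x (y # w) = (if y = inv_letter x then w else x # y # w)"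

definition reduce :: "group_letter list \<Rightarrow> group_letter list" where
  "reduce w = foldr reduced_Cons w []"

definition free_group :: "nat \<Rightarrow> group_letter list monoid" where
  "free_group d =
     \<lparr>carrier = {w. set w \<subseteq> {1..d} \<times> UNIV \<and> reduced w},
      monoid.mult = (\<lambda>u v. reduce (u @ v)),
      one = []\<rparr>"

definition free_gen :: "nat \<Rightarrow> group_letter list" where
  "free_gen i = [(i, True)]"

definition regular_tree :: "nat \<Rightarrow> group_letter list pair_pre_digraph" where
  "regular_tree d =
     \<lparr>pverts = carrier (free_group d),
      parcs = {(v, v \<otimes>\<^bsub>free_group d\<^esub> free_gen i) | v i. v \<in> carrier (free_group d) \<and> i \<in> {1..d}}\<rparr>"

definition star_moment :: "nat \<Rightarrow> star_letter list \<Rightarrow> real" where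
  "star_moment d w = word_entry (regular_tree d) w \<one>\<^bsub>free_group d\<^esub> \<one>\<^bsub>free_group d\<^esub>"

text \<open>\<open>free_group d\<close> is a group, and it has the universal property of the free group.\<close>

lemma inv_letter_inv_letter [simp]: "inv_letter (inv_letter x) = x"
  by (simp add: inv_letter_def)

lemma reduced_Nil [simp]: "reduced []"
  by (simp add: reduced_def)

lemma reduced_singleton [simp]: "reduced [x]"
  by (simp add: reduced_def)

lemma reduced_Cons_Cons [simp]:
  "reduced (x # y # w) \<longleftrightarrow> y \<noteq> inv_letter x \<and> reduced (y # w)"
  by (simp add: reduced_def)

lemma reduced_tl: "reduced (x # w) \<Longrightarrow> reduced w"
  by (cases w) auto

lemma reduced_reduced_Cons: "reduced w \<Longrightarrow> reduced (reduced_Cons x w)"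
  by (cases w) (auto dest: reduced_tl)

lemma reduce_simps [simp]:
  "reduce [] = []" "reduce (x # w) = reduced_Cons x (reduce w)"
  by (simp_all add: reduce_def)

lemma reduced_reduce: "reduced (reduce w)"
  by (induction w) (auto intro: reduced_reduced_Cons)

lemma reduced_Cons_eq: "reduced (x # w) \<Longrightarrow> reduced_Cons x w = x # w"
  by (cases w) auto

lemma reduce_reduced: "reduced w \<Longrightarrow> reduce w = w"
proof (induction w)
  case (Cons x w)
  then show ?case
    using reduced_tl[of x w] by (simp add: reduced_Cons_eq)
qed simp

lemma reduced_Cons_inv_cancel:
  "reduced w \<Longrightarrow> reduced_Cons x (reduced_Cons (inv_letter x) w) = w"
  by (cases w) (auto simp: reduced_Cons_eq)

lemma reduce_append: "reduce (u @ v) = foldr reduced_Cons u (reduce v)"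
  by (simp add: reduce_def)

lemma foldr_reduced_Cons_reduced:
  "reduced w \<Longrightarrow> reduced (foldr reduced_Cons u w)"
  by (induction u) (auto intro: reduced_reduced_Cons)

lemma foldr_reduced_Cons:
  assumes "reduced w"
  shows "foldr reduced_Cons (reduced_Cons x u) w = reduced_Cons x (foldr reduced_Cons u w)"
proof (cases u)
  case (Cons y u')
  then show ?thesis
    using reduced_Cons_inv_cancel[OF foldr_reduced_Cons_reduced[OF assms]] by auto
qed simp

lemma foldr_reduce:
  assumes "reduced w"
  shows "foldr reduced_Cons (reduce u) w = foldr reduced_Cons u w"
  by (induction u) (auto simp: foldr_reduced_Cons[OF assms])

lemma reduce_reduce_left: "reduce (reduce u @ v) = reduce (u @ v)"
  by (simp add: reduce_append foldr_reduce reduced_reduce)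

lemma reduce_reduce_right: "reduce (u @ reduce v) = reduce (u @ v)"
  by (simp add: reduce_append reduce_reduced reduced_reduce)

lemma set_reduced_Cons: "set (reduced_Cons x w) \<subseteq> insert x (set w)"
  by (cases w) auto

lemma set_reduce: "set (reduce w) \<subseteq> set w"
  by (induction w) (use set_reduced_Cons in fastforce)+

lemma reduce_inverse: "reduce (rev (map inv_letter w) @ w) = []"
proof (induction w)
  case (Cons x w)
  have "reduce (rev (map inv_letter (x # w)) @ x # w) =
          foldr reduced_Cons (rev (map inv_letter w))
            (reduced_Cons (inv_letter x) (reduced_Cons x (reduce w)))"
    by (simp add: reduce_append)
  also have "\<dots> = reduce (rev (map inv_letter w) @ w)"
    using reduced_Cons_inv_cancel[OF reduced_reduce, of "inv_letter x" w]
    by (simp add: reduce_append)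
  finally show ?case
    using Cons.IH by simp
qed simp

lemma group_free_group: "group (free_group d)"
proof (rule groupI)
  fix x y z
  assume "x \<in> carrier (free_group d)" "y \<in> carrier (free_group d)" "z \<in> carrier (free_group d)"
  show "x \<otimes>\<^bsub>free_group d\<^esub> y \<otimes>\<^bsub>free_group d\<^esub> z = x \<otimes>\<^bsub>free_group d\<^esub> (y \<otimes>\<^bsub>free_group d\<^esub> z)"
    by (simp add: free_group_def reduce_reduce_left reduce_reduce_right)
next
  fix x y
  assume "x \<in> carrier (free_group d)" "y \<in> carrier (free_group d)"
  then show "x \<otimes>\<^bsub>free_group d\<^esub> y \<in> carrier (free_group d)"
    using set_reduce[of "x @ y"] by (auto simp: free_group_def reduced_reduce)
next
  fix x
  assume x: "x \<in> carrier (free_group d)"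
  let ?y = "reduce (rev (map inv_letter x))"
  have "set ?y \<subseteq> {1..d} \<times> UNIV"
    using set_reduce[of "rev (map inv_letter x)"] x
    by (fastforce simp: free_group_def inv_letter_def)
  then have "?y \<in> carrier (free_group d)"
    by (simp add: free_group_def reduced_reduce)
  moreover have "?y \<otimes>\<^bsub>free_group d\<^esub> x = \<one>\<^bsub>free_group d\<^esub>"
    by (simp add: free_group_def reduce_reduce_left reduce_inverse)
  ultimately show "\<exists>y\<in>carrier (free_group d). y \<otimes>\<^bsub>free_group d\<^esub> x = \<one>\<^bsub>free_group d\<^esub>"
    by blast
qed (simp_all add: free_group_def reduce_reduced)

lemma free_gen_in_carrier: "i \<in> {1..d} \<Longrightarrow> free_gen i \<in> carrier (free_group d)"
  by (simp add: free_gen_def free_group_def)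

definition letter_value :: "('b, 'c) monoid_scheme \<Rightarrow> (nat \<Rightarrow> 'b) \<Rightarrow> group_letter \<Rightarrow> 'b" where
  "letter_value H f x = (if snd x then f (fst x) else inv\<^bsub>H\<^esub> f (fst x))"

definition word_value :: "('b, 'c) monoid_scheme \<Rightarrow> (nat \<Rightarrow> 'b) \<Rightarrow> group_letter list \<Rightarrow> 'b" where
  "word_value H f w = foldr (\<lambda>x g. letter_value H f x \<otimes>\<^bsub>H\<^esub> g) w \<one>\<^bsub>H\<^esub>"

lemma free_group_universal:
  assumes "group H" and f: "f \<in> {1..d} \<rightarrow> carrier H"
  shows "\<exists>h\<in>hom (free_group d) H. (\<forall>i\<in>{1..d}. h (free_gen i) = f i) \<and>
           (\<forall>h'\<in>hom (free_group d) H. (\<forall>i\<in>{1..d}. h' (free_gen i) = f i) \<longrightarrow>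
              (\<forall>w\<in>carrier (free_group d). h' w = h w))"
proof -
  interpret H: group H by fact
  interpret F: group "free_group d" by (rule group_free_group)
  let ?L = "{1..d} \<times> (UNIV :: bool set)"
  let ?l = "letter_value H f" and ?h = "word_value H f"
  have h_simps [simp]: "?h [] = \<one>\<^bsub>H\<^esub>" "?h (x # w) = ?l x \<otimes>\<^bsub>H\<^esub> ?h w" for x w
    by (simp_all add: word_value_def)
  have l: "?l x \<in> carrier H" if "x \<in> ?L" for x
    using that f by (auto simp: letter_value_def)
  have l_inv: "?l (inv_letter x) = inv\<^bsub>H\<^esub> ?l x" if "x \<in> ?L" for x
    using that funcset_mem[OF f, of "fst x"] by (auto simp: letter_value_def inv_letter_def)
  have h: "?h w \<in> carrier H" if "set w \<subseteq> ?L" for w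
    using that by (induction w) (simp_all add: l del: mem_Sigma_iff)
  have h_append: "?h (u @ v) = ?h u \<otimes>\<^bsub>H\<^esub> ?h v" if "set u \<subseteq> ?L" "set v \<subseteq> ?L" for u v
    using that by (induction u) (simp_all add: h l H.m_assoc del: mem_Sigma_iff)
  have h_Cons: "?h (reduced_Cons x w) = ?l x \<otimes>\<^bsub>H\<^esub> ?h w" if x: "x \<in> ?L" and w: "set w \<subseteq> ?L" for x w
  proof (cases w)
    case (Cons y w')
    have "?l x \<otimes>\<^bsub>H\<^esub> (inv\<^bsub>H\<^esub> ?l x \<otimes>\<^bsub>H\<^esub> ?h w') = ?h w'"
      using l[OF x] h[of w'] w Cons by (simp add: H.m_assoc[symmetric])
    then show ?thesis
      using Cons l_inv[OF x] by auto
  qed simp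
  have h_reduce: "?h (reduce w) = ?h w" if "set w \<subseteq> ?L" for w
    using that
  proof (induction w)
    case (Cons x w)
    then show ?case
      using h_Cons[of x "reduce w"] set_reduce[of w] by auto
  qed simp
  have hom: "?h \<in> hom (free_group d) H"
  proof (rule homI)
    fix u v assume "u \<in> carrier (free_group d)" "v \<in> carrier (free_group d)"
    then show "?h (u \<otimes>\<^bsub>free_group d\<^esub> v) = ?h u \<otimes>\<^bsub>H\<^esub> ?h v"
      using h_reduce[of "u @ v"] h_append[of u v] by (auto simp: free_group_def)
  qed (simp add: free_group_def h del: One_nat_def)
  have gen: "?h (free_gen i) = f i" if "i \<in> {1..d}" for i
    using funcset_mem[OF f that] by (simp add: free_gen_def letter_value_def)
  have unique: "h' w = ?h w"
    if h': "h' \<in> hom (free_group d) H" and agree: "\<And>i. i \<in> {1..d} \<Longrightarrow> h' (free_gen i) = f i"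
      and w: "w \<in> carrier (free_group d)" for h' w
  proof -
    interpret h': group_hom "free_group d" H h'
      by (intro group_hom.intro group_hom_axioms.intro h' group_free_group \<open>group H\<close>)
    have letter: "h' [x] = ?l x" if x_in: "x \<in> ?L" for x
    proof (cases "snd x")
      case True
      then show ?thesis
        using agree[of "fst x"] that
        by (cases x) (auto simp: letter_value_def free_gen_def)
    next
      case False
      obtain i where x: "x = (i, False)" "i \<in> {1..d}"
        using False x_in by (cases x) auto
      have "[x] \<otimes>\<^bsub>free_group d\<^esub> free_gen i = \<one>\<^bsub>free_group d\<^esub>" "[x] \<in> carrier (free_group d)"
        using x by (auto simp: free_group_def free_gen_def inv_letter_def)
      then have "[x] = inv\<^bsub>free_group d\<^esub> free_gen i"
        using F.inv_equality free_gen_in_carrier[OF x(2)] by metis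
      then show ?thesis
        using agree[OF x(2)] x free_gen_in_carrier[OF x(2)] h'.hom_inv
        by (simp add: letter_value_def)
    qed
    show ?thesis
      using w
    proof (induction w)
      case Nil
      then show ?case
        using h'.hom_one by (simp add: free_group_def)
    next
      case (Cons x w)
      then have w: "w \<in> carrier (free_group d)" and x: "x \<in> ?L" and "reduced (x # w)"
        by (auto simp: free_group_def dest: reduced_tl)
      then have "[x] \<in> carrier (free_group d)" "x # w = [x] \<otimes>\<^bsub>free_group d\<^esub> w"
        by (auto simp: free_group_def reduce_reduced reduced_Cons_eq reduced_tl)
      then show ?case
        using h'.hom_mult[of "[x]" w] w letter[OF x] Cons.IH by (metis h_simps(2))
    qed
  qed
  show ?thesis
    using hom gen unique by blast
qed

lemma pair_wf_digraph_regular_tree: "pair_wf_digraph (regular_tree d)"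
proof -
  interpret group "free_group d" by (rule group_free_group)
  show ?thesis
    by unfold_locales (auto simp: regular_tree_def intro!: m_closed free_gen_in_carrier)
qed

lemma regular_tree_locally_finite:
  assumes "v \<in> pverts (regular_tree d)"
  shows "finite {u. (v, u) \<in> parcs (regular_tree d) \<or> (u, v) \<in> parcs (regular_tree d)}"
proof -
  interpret group "free_group d" by (rule group_free_group)
  have "u = v \<otimes>\<^bsub>free_group d\<^esub> inv\<^bsub>free_group d\<^esub> free_gen i"
    if "u \<in> carrier (free_group d)" "i \<in> {1..d}" "v = u \<otimes>\<^bsub>free_group d\<^esub> free_gen i" for u i
    using that free_gen_in_carrier[OF that(2)] by (simp add: m_assoc)
  then have "{u. (v, u) \<in> parcs (regular_tree d) \<or> (u, v) \<in> parcs (regular_tree d)} \<subseteq>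
      (\<lambda>i. v \<otimes>\<^bsub>free_group d\<^esub> free_gen i) ` {1..d} \<union>
      (\<lambda>i. v \<otimes>\<^bsub>free_group d\<^esub> inv\<^bsub>free_group d\<^esub> free_gen i) ` {1..d}"
    unfolding regular_tree_def by (fastforce intro: rev_image_eqI)
  then show ?thesis
    by (rule finite_subset) simp
qed

end

theory Submission
  imports Defs
begin

text \<open>
  Undoing immediate backtracking turns a walk from \<open>v\<close> into a nonbacktracking one. If no
  nonempty closed nonbacktracking walk of length at most \<open>k\<close> starts at \<open>v\<close>, then a walk of
  length \<open>k\<close> closes up exactly when it reduces to the empty walk, and by \<open>d\<close>-regularity the
  number of such walks along \<open>w\<close> depends on \<open>d\<close> and \<open>w\<close> only. In the tree this applies at the
  root, so that this number is the star moment. In a finite digraph, a closed nonbacktracking walk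
  contains a plain cycle; hence all exceptional vertices lie within distance \<open>k\<close> of a plain cycle
  of length at most \<open>k\<close>, and each of them contributes an error of at most \<open>d\<^sup>k\<close> to the trace.
\<close>

section \<open>Walks\<close>

fun flip :: "star_letter \<Rightarrow> star_letter" where
  "flip One = Star"
| "flip Star = One"

lemma flip_flip [simp]: "flip (flip x) = x"
  by (cases x) auto

lemma flip_neq [simp]: "flip x \<noteq> x" "x \<noteq> flip x"
  by (cases x; simp)+

lemma flip_eq_iff: "y \<noteq> x \<longleftrightarrow> y = flip x"
  by (cases x; cases y) auto

lemma orient_flip: "orient (flip x) (u, v) = orient x (v, u)"
  by (cases x) (auto simp: orient_def)

lemma orient_eq_iff [simp]: "orient x e = orient x e' \<longleftrightarrow> e = e'"
  by (cases x; cases e; cases e') (auto simp: orient_def)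

lemma orient_eqD: "orient x (u, v) = orient y (u', v') \<Longrightarrow> u = u' \<and> v = v' \<or> u = v' \<and> v = u'"
  by (cases x; cases y) (auto simp: orient_def)

definition nbrs :: "'a pair_pre_digraph \<Rightarrow> star_letter \<Rightarrow> 'a \<Rightarrow> 'a set" where
  "nbrs G x u = {v. orient x (u, v) \<in> parcs G}"

lemma nbrs_flip: "v \<in> nbrs G (flip x) u \<longleftrightarrow> u \<in> nbrs G x v"
  by (simp add: nbrs_def orient_flip)

lemma nbrs_flip': "v \<in> nbrs G x u \<Longrightarrow> u \<in> nbrs G (flip x) v"
  by (simp add: nbrs_flip)

lemma mat_letter_adj_matrix: "mat_letter (adj_matrix G) x u v = of_bool (v \<in> nbrs G x u)"
  by (cases x) (auto simp: mat_letter_def adj_matrix_def nbrs_def orient_def)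

definition is_walk :: "'a pair_pre_digraph \<Rightarrow> star_letter list \<Rightarrow> 'a list \<Rightarrow> bool" where
  "is_walk G w vs \<longleftrightarrow> length vs = length w + 1 \<and> set vs \<subseteq> pverts G \<and>
     (\<forall>i<length w. vs ! Suc i \<in> nbrs G (w ! i) (vs ! i))"

abbreviation step_arc :: "star_letter list \<Rightarrow> 'a list \<Rightarrow> nat \<Rightarrow> 'a \<times> 'a" where
  "step_arc w vs i \<equiv> orient (w ! i) (vs ! i, vs ! Suc i)"

text \<open>In the absence of loops, consecutive arcs of a walk coincide only if the walk turns back.\<close>

definition nonbacktracking :: "star_letter list \<Rightarrow> 'a list \<Rightarrow> bool" where
  "nonbacktracking w vs \<longleftrightarrow>
     (\<forall>i. Suc i < length w \<longrightarrow> step_arc w vs i \<noteq> step_arc w vs (Suc i))"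

lemma path_weight_eq:
  "path_weight G w vs = of_bool (\<forall>i<length w. vs ! Suc i \<in> nbrs G (w ! i) (vs ! i))"
  by (auto simp: path_weight_def mat_letter_adj_matrix prod_zero_iff)

lemma is_walk_Nil: "is_walk G [] vs \<longleftrightarrow> (\<exists>u\<in>pverts G. vs = [u])"
  by (auto simp: is_walk_def length_Suc_conv)

lemma is_walk_Cons:
  "is_walk G (x # w) vs \<longleftrightarrow>
     (\<exists>u us. vs = u # us \<and> u \<in> pverts G \<and> is_walk G w us \<and> hd us \<in> nbrs G x u)"
proof (cases vs)
  case (Cons u us)
  then show ?thesis
    by (cases us) (auto simp: is_walk_def All_less_Suc2 nth_Cons split: nat.splits)
qed (auto simp: is_walk_def)

lemma nonbacktracking_Cons2:
  "nonbacktracking (x # y # w) (u # us) \<longleftrightarrow>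
     orient x (u, us ! 0) \<noteq> orient y (us ! 0, us ! 1) \<and> nonbacktracking (y # w) us"
  by (auto simp: nonbacktracking_def nth_Cons split: nat.splits)

lemma nonbacktracking_short [simp]: "nonbacktracking [] vs" "nonbacktracking [x] vs"
  by (auto simp: nonbacktracking_def)

lemma nonbacktracking_Cons:
  "nonbacktracking (x # w) (u # us) \<Longrightarrow> nonbacktracking w us"
  by (cases w) (auto simp: nonbacktracking_Cons2)

text \<open>The recursion peels off the first letter, as \<open>mat_word\<close> and
  \<open>tree_count\<close> do, so that both comparisons below are inductions on the word.\<close>

fun walk_count :: "'a pair_pre_digraph \<Rightarrow> star_letter list \<Rightarrow> 'a \<Rightarrow> 'a \<Rightarrow> nat" where
  "walk_count G [] u v = of_bool (u = v)"
| "walk_count G (x # w) u v = (\<Sum>u'\<in>nbrs G x u. walk_count G w u' v)"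

text \<open>The stack \<open>s\<close> holds the letters that lead back from the current vertex to the start along
  the reduced form of the walk read so far. In a \<open>d\<close>-regular digraph, a new letter that agrees
  with the top of the stack has one continuation that backtracks and \<open>d - 1\<close> that do not. The
  value counts the continuations along \<open>w\<close> which empty the stack.\<close>

fun tree_count :: "nat \<Rightarrow> star_letter list \<Rightarrow> star_letter list \<Rightarrow> nat" where
  "tree_count d [] s = of_bool (s = [])"
| "tree_count d (x # w) s =
     (if s \<noteq> [] \<and> hd s = x then tree_count d w (tl s) + (d - 1) * tree_count d w (flip x # s)
      else d * tree_count d w (flip x # s))"

text \<open>In both branches the coefficients add up to \<open>d\<close>. For the split
  \<open>1 + (d - 1)\<close> with truncated subtraction this uses \<open>d \<ge> 1\<close>.\<close>

lemma tree_count_le: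
  assumes "d \<ge> 1"
  shows "tree_count d w s \<le> d ^ length w"
proof (induction w arbitrary: s)
  case (Cons x w)
  have "tree_count d w (tl s) + (d - 1) * tree_count d w (flip x # s)
          \<le> d ^ length w + (d - 1) * d ^ length w"
    by (intro add_mono mult_left_mono Cons.IH) auto
  also have "\<dots> = d ^ length (x # w)"
    using assms by (cases d) auto
  finally show ?case
    using Cons.IH[of "flip x # s"] by auto
qed auto

text \<open>The vertex set may be infinite, so that the finite digraphs and the tree are instances
  of one counting argument. Finiteness is assumed separately because \<open>card\<close> is 0 on
  infinite sets, which would leave it open for \<open>d = 0\<close>.\<close>

locale regular_loopfree_digraph = pair_loopfree_digraph G for G :: "'a pair_pre_digraph" +
  fixes d :: nat
  assumes finite_nbrs: "u \<in> pverts G \<Longrightarrow> finite (nbrs G x u)"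
    and card_nbrs: "u \<in> pverts G \<Longrightarrow> card (nbrs G x u) = d"
begin

lemma nbrs_verts: "v \<in> nbrs G x u \<Longrightarrow> v \<in> pverts G" "v \<in> nbrs G x u \<Longrightarrow> u \<in> pverts G"
  by (cases x; auto simp: nbrs_def orient_def dest: in_arcsD1 in_arcsD2)+

lemma nbrs_irrefl: "v \<in> nbrs G x u \<Longrightarrow> u \<noteq> v"
  by (cases x) (auto simp: nbrs_def orient_def dest: pair_no_loops)

lemma walk_count_le: "u \<in> pverts G \<Longrightarrow> walk_count G w u v \<le> d ^ length w"
proof (induction w arbitrary: u)
  case (Cons x w)
  have "(\<Sum>u'\<in>nbrs G x u. walk_count G w u' v) \<le> of_nat (card (nbrs G x u)) * d ^ length w"
    by (intro sum_bounded_above Cons.IH nbrs_verts)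
  then show ?case
    using card_nbrs[OF Cons.prems] by simp
qed auto

text \<open>The invariant of the stack argument: \<open>ys\<close> with vertices \<open>ps\<close>
  is the reduced walk leading from the current vertex \<open>hd ps\<close> back to \<open>v\<close>.
  A letter either pops its first step or pushes a new one, and \<open>length ys + length w\<close>
  never grows. Once \<open>w\<close> is used up, \<open>no_cycle\<close> says that the walk is back
  at \<open>v\<close> only if the stack is empty.\<close>

lemma walk_count_eq_tree_count:
  assumes no_cycle: "\<And>ys ps. is_walk G ys ps \<Longrightarrow> nonbacktracking ys ps \<Longrightarrow> last ps = v \<Longrightarrow>
      ys \<noteq> [] \<Longrightarrow> length ys \<le> k \<Longrightarrow> hd ps \<noteq> v"
    and "is_walk G ys ps" "nonbacktracking ys ps" "last ps = v" "length ys + length w \<le> k"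
  shows "walk_count G w (hd ps) v = tree_count d w ys"
  using assms(2-)
proof (induction w arbitrary: ys ps)
  case Nil
  show ?case
  proof (cases "ys = []")
    case True
    then show ?thesis
      using Nil by (auto simp: is_walk_Nil)
  next
    case False
    then show ?thesis
      using no_cycle[OF Nil(1-3)] Nil(4) by simp
  qed
next
  case (Cons x w)
  obtain u ps' where ps: "ps = u # ps'" and u: "u \<in> pverts G"
    using Cons.prems(1) by (cases ys) (auto simp: is_walk_Nil is_walk_Cons)
  \<comment> \<open>Every step that does not reverse the first step of the stored walk keeps it
    nonbacktracking.\<close>
  have push: "walk_count G w u' v = tree_count d w (flip x # ys)"
    if u': "u' \<in> nbrs G x u" and turn: "ys \<noteq> [] \<Longrightarrow> hd ys = x \<Longrightarrow> hd ps' \<noteq> u'" for u'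
  proof -
    have "is_walk G (flip x # ys) (u' # ps)"
      using Cons.prems(1) u' nbrs_verts[OF u'] by (simp add: is_walk_Cons ps nbrs_flip)
    moreover have "nonbacktracking (flip x # ys) (u' # ps)"
    proof (cases ys)
      case (Cons y ys')
      obtain p ps'' where ps': "ps' = p # ps''"
        using Cons.prems(1) unfolding Cons ps by (cases ys') (auto simp: is_walk_Nil is_walk_Cons)
      have p: "p \<in> nbrs G y u"
        using Cons.prems(1) by (simp add: is_walk_Cons Cons ps ps')
      have "orient (flip x) (u', u) \<noteq> orient y (u, p)"
      proof (cases "y = x")
        case True
        then show ?thesis
          using turn by (simp add: orient_flip Cons ps')
      next
        case False
        \<comment> \<open>Both steps now carry the letter \<open>flip x\<close>, so equal arcs would
          force a loop at \<open>u\<close>. If \<open>u' = p\<close>, the walk returns along the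
          opposite arc, which is not backtracking.\<close>
        then have "y = flip x"
          by (simp add: flip_eq_iff)
        then show ?thesis
          using nbrs_irrefl[OF p] by simp
      qed
      then show ?thesis
        using Cons.prems(2) by (simp add: Cons ps ps' nonbacktracking_Cons2)
    qed simp
    moreover have "last (u' # ps) = v"
      using Cons.prems(3) by (simp add: ps)
    ultimately show ?thesis
      using Cons.IH[of "flip x # ys" "u' # ps"] Cons.prems(4) by simp
  qed
  show ?case
  proof (cases "ys \<noteq> [] \<and> hd ys = x")
    case False
    then have "(\<Sum>u'\<in>nbrs G x u. walk_count G w u' v)
        = (\<Sum>u'\<in>nbrs G x u. tree_count d w (flip x # ys))"
      by (intro sum.cong push) auto
    then show ?thesis
      using False card_nbrs[OF u] by (auto simp: ps)
  next
    case True
    then obtain ys' where ys: "ys = x # ys'"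
      by (cases ys) auto
    then have ps': "is_walk G ys' ps'" "hd ps' \<in> nbrs G x u" "nonbacktracking ys' ps'"
      using Cons.prems(1,2) nonbacktracking_Cons[of x ys' u ps'] by (auto simp: is_walk_Cons ps)
    then have "last ps' = v"
      using Cons.prems(3) by (auto simp: ps is_walk_def split: if_splits)
    then have pop: "walk_count G w (hd ps') v = tree_count d w ys'"
      using Cons.IH[OF ps'(1,3)] Cons.prems(4) ys by simp
    \<comment> \<open>The only backtracking continuation, to \<open>hd ps'\<close>, is split off;
      the other \<open>d - 1\<close> push.\<close>
    have "(\<Sum>u'\<in>nbrs G x u. walk_count G w u' v) = walk_count G w (hd ps') v
        + (\<Sum>u'\<in>nbrs G x u - {hd ps'}. walk_count G w u' v)"
      using ps'(2) finite_nbrs[OF u] by (simp add: sum.remove)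
    also have "(\<Sum>u'\<in>nbrs G x u - {hd ps'}. walk_count G w u' v)
        = (\<Sum>u'\<in>nbrs G x u - {hd ps'}. tree_count d w (flip x # ys))"
      by (intro sum.cong push) auto
    also have "\<dots> = (d - 1) * tree_count d w (flip x # ys)"
      using ps'(2) finite_nbrs[OF u] card_nbrs[OF u] by simp
    finally show ?thesis
      using ys pop by (simp add: ps)
  qed
qed

lemma walk_count_closed:
  assumes "v \<in> pverts G"
    and "\<And>ys ps. is_walk G ys ps \<Longrightarrow> nonbacktracking ys ps \<Longrightarrow> last ps = v \<Longrightarrow>
      ys \<noteq> [] \<Longrightarrow> length ys \<le> length w \<Longrightarrow> hd ps \<noteq> v"
  shows "walk_count G w v v = tree_count d w []"
  using walk_count_eq_tree_count[where ys = "[]" and ps = "[v]" and k = "length w" and v = v] assms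
  by (simp add: is_walk_Nil)

section \<open>Matrix entries as numbers of walks\<close>

lemma mat_word_eq_walk_count:
  assumes "finite (pverts G)" "u \<in> pverts G"
  shows "mat_word (pverts G) (adj_matrix G) w u v = real (walk_count G w u v)"
  using assms(2)
proof (induction w arbitrary: u)
  case Nil
  then show ?case
    by (simp add: mat_word_def mat_one_def)
next
  case (Cons x w)
  have sub: "nbrs G x u \<subseteq> pverts G"
    using nbrs_verts by blast
  have "mat_word (pverts G) (adj_matrix G) (x # w) u v
      = (\<Sum>u'\<in>pverts G. of_bool (u' \<in> nbrs G x u) * mat_word (pverts G) (adj_matrix G) w u' v)"
    by (simp add: mat_word_def mat_mult_on_def mat_letter_adj_matrix)
  also have "\<dots> = (\<Sum>u'\<in>nbrs G x u. mat_word (pverts G) (adj_matrix G) w u' v)"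
    by (rule sum.mono_neutral_cong_right) (use sub assms(1) in auto)
  also have "\<dots> = (\<Sum>u'\<in>nbrs G x u. real (walk_count G w u' v))"
    by (intro sum.cong Cons.IH) (use sub in auto)
  finally show ?case
    by simp
qed

text \<open>Finiteness is carried through the induction because the cardinality of the disjoint
  union over the first step depends on it.\<close>

lemma card_walks:
  assumes "u \<in> pverts G"
  shows "finite {vs. is_walk G w vs \<and> hd vs = u \<and> last vs = v} \<and>
    card {vs. is_walk G w vs \<and> hd vs = u \<and> last vs = v} = walk_count G w u v"
  using assms
proof (induction w arbitrary: u)
  case Nil
  have "{vs. is_walk G [] vs \<and> hd vs = u \<and> last vs = v} = (if u = v then {[u]} else {})"
    using Nil by (auto simp: is_walk_Nil)
  then show ?case
    by simp
next
  case (Cons x w)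
  let ?W = "\<lambda>u. {vs. is_walk G w vs \<and> hd vs = u \<and> last vs = v}"
  have ne: "us \<noteq> []" if "is_walk G w us" for us
    using that by (auto simp: is_walk_def)
  have eq: "{vs. is_walk G (x # w) vs \<and> hd vs = u \<and> last vs = v}
      = (#) u ` (\<Union>u'\<in>nbrs G x u. ?W u')"
    using Cons.prems by (auto simp: is_walk_Cons ne image_iff)
  have IH: "finite (?W u')" "card (?W u') = walk_count G w u' v" if "u' \<in> nbrs G x u" for u'
    using Cons.IH[of u'] nbrs_verts(1)[OF that] by auto
  have "card (\<Union>u'\<in>nbrs G x u. ?W u') = (\<Sum>u'\<in>nbrs G x u. card (?W u'))"
    by (rule card_UN_disjoint) (use IH finite_nbrs[OF Cons.prems] in auto)
  also have "\<dots> = walk_count G (x # w) u v"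
    using IH by simp
  finally show ?case
    using IH finite_nbrs[OF Cons.prems] unfolding eq by (simp add: card_image)
qed

lemma word_entry_eq_walk_count:
  assumes "u \<in> pverts G"
  shows "word_entry G w u v = real (walk_count G w u v)"
proof -
  let ?W = "{vs. is_walk G w vs \<and> hd vs = u \<and> last vs = v}"
  have hd_last: "hd vs = vs ! 0" "last vs = vs ! length w" if "length vs = length w + 1" for vs :: "'a list"
  proof -
    have "vs \<noteq> []"
      using that by auto
    then show "hd vs = vs ! 0" "last vs = vs ! length w"
      using that by (auto simp: hd_conv_nth last_conv_nth)
  qed
  \<comment> \<open>Walks have weight 1 and all other vertex sequences have weight 0.\<close>
  have "word_entry G w u v = infsum (\<lambda>_. 1 :: real) ?W"
    unfolding word_entry_def
    by (rule infsum_cong_neutral) (auto simp: is_walk_def path_weight_eq hd_last split: if_splits)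
  then show ?thesis
    using card_walks[OF assms, of w v] by simp
qed


end

section \<open>Plain cycles\<close>

text \<open>Here cycles carry a starting point and a direction, so these are the nonzero terms of
  \<open>plain_cycles\<close> before the division by \<open>2 * real j\<close>.\<close>

definition plain_cycle_set :: "nat \<Rightarrow> 'a pair_pre_digraph \<Rightarrow> (star_letter list \<times> 'a list) set" where
  "plain_cycle_set j G =
     {(w, vs). length w = j \<and> is_walk G w vs \<and> vs ! j = vs ! 0 \<and> inj_on (step_arc w vs) {..<j}}"

lemma card_plain_cycle_set:
  assumes "finite (pverts G)" "j \<ge> 1"
  shows "finite (plain_cycle_set j G)"
    and "real (card (plain_cycle_set j G)) = 2 * real j * plain_cycles j G"
proof -
  let ?L = "{w :: star_letter list. length w = j}"
  let ?V = "{vs. length vs = j + 1 \<and> set vs \<subseteq> pverts G}"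
  let ?B = "\<lambda>w. {vs \<in> ?V. vs ! j = vs ! 0 \<and> inj_on (step_arc w vs) {..<j}}"
  let ?C = "\<lambda>w. {vs \<in> ?B w. is_walk G w vs}"
  have "finite ?V"
    using finite_lists_length_eq[OF assms(1), of "j + 1"] by (simp add: conj_commute)
  then have fin: "finite (?B w)" "finite (?C w)" for w
    by (rule rev_finite_subset; auto)+
  have eq: "plain_cycle_set j G = (SIGMA w:?L. ?C w)"
    by (auto simp: plain_cycle_set_def is_walk_def)
  then show "finite (plain_cycle_set j G)"
    using fin finite_star_words by (simp add: finite_SigmaI)
  have "(\<Sum>vs\<in>?B w. path_weight G w vs) = real (card (?C w))" if "w \<in> ?L" for w
  proof -
    have "(\<Sum>vs\<in>?B w. path_weight G w vs) = (\<Sum>vs\<in>?C w. 1)"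
      by (rule sum.mono_neutral_cong_right)
        (use fin that in \<open>auto simp: path_weight_eq is_walk_def\<close>)
    then show ?thesis
      by simp
  qed
  then have "(\<Sum>w\<in>?L. \<Sum>vs\<in>?B w. path_weight G w vs) = (\<Sum>w\<in>?L. real (card (?C w)))"
    by (intro sum.cong) auto
  also have "\<dots> = real (card (plain_cycle_set j G))"
    unfolding eq using fin finite_star_words by (subst card_SigmaI) auto
  finally show "real (card (plain_cycle_set j G)) = 2 * real j * plain_cycles j G"
    using assms(2) by (simp add: plain_cycles_def conj_assoc)
qed

text \<open>A shortest closed segment of the walk is a plain cycle.\<close>

lemma closed_nonbacktracking_walk_contains_plain_cycle:
  assumes walk: "is_walk G w vs" and nb: "nonbacktracking w vs" and "w \<noteq> []" "hd vs = last vs"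
  obtains i j w' vs' where "1 \<le> j" "i + j \<le> length w" "(w', vs') \<in> plain_cycle_set j G"
    "vs' ! 0 = vs ! i"
proof -
  have len: "length vs = length w + 1"
    using walk by (simp add: is_walk_def)
  define P where "P j \<longleftrightarrow> 1 \<le> j \<and> (\<exists>i. i + j \<le> length w \<and> vs ! i = vs ! (i + j))" for j
  have "vs \<noteq> []"
    using len by auto
  then have "P (length w)"
    using assms(3,4) len by (auto simp: P_def hd_conv_nth last_conv_nth Suc_le_eq intro!: exI[of _ 0])
  define j where "j = (LEAST j. P j)"
  have "P j"
    unfolding j_def using \<open>P (length w)\<close> by (rule LeastI)
  then obtain i where j: "1 \<le> j" and ij: "i + j \<le> length w" and closed: "vs ! i = vs ! (i + j)"
    by (auto simp: P_def)
  \<comment> \<open>By minimality of \<open>j\<close>, vertices of the segment at index distance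
    below \<open>j\<close> differ; only its two ends coincide.\<close>
  have distinct: "vs ! (i + a) \<noteq> vs ! (i + b)" if "a < b" "b - a < j" "b \<le> j" for a b
  proof
    assume "vs ! (i + a) = vs ! (i + b)"
    then have "P (b - a)"
      using that ij by (auto simp: P_def intro!: exI[of _ "i + a"])
    then have "j \<le> b - a"
      unfolding j_def by (rule Least_le)
    then show False
      using that by simp
  qed
  \<comment> \<open>Equal arcs with different first vertices are traversed in opposite directions,
    so the walk is at the same vertex after step \<open>a\<close> and before step \<open>b\<close>.
    By \<open>distinct\<close> this means \<open>b = Suc a\<close>, an immediate backtrack.\<close>
  have arcs: "step_arc w vs (i + a) \<noteq> step_arc w vs (i + b)" if "a < b" "b < j" for a b
  proof
    assume eq: "step_arc w vs (i + a) = step_arc w vs (i + b)"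
    have "vs ! (i + a) \<noteq> vs ! (i + b)"
      using distinct[of a b] that by simp
    then have "vs ! (i + Suc a) = vs ! (i + b)"
      using orient_eqD[OF eq] by auto
    moreover have "b - Suc a < j"
      using that by simp
    ultimately have "b = Suc a"
      using distinct[of "Suc a" b] that by (cases "Suc a < b") auto
    then show False
      using nb eq that ij by (auto simp: nonbacktracking_def)
  qed
  define w' where "w' = take j (drop i w)"
  define vs' where "vs' = take (j + 1) (drop i vs)"
  have nth: "w' ! a = w ! (i + a)" "vs' ! a = vs ! (i + a)" "vs' ! Suc a = vs ! Suc (i + a)"
    if "a < j" for a
    using that ij len by (auto simp: w'_def vs'_def)
  have "is_walk G w' vs'"
    using walk ij nth unfolding is_walk_def
    by (auto simp: w'_def vs'_def dest!: in_set_takeD in_set_dropD)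
  moreover have "inj_on (step_arc w' vs') {..<j}"
  proof (rule linorder_inj_onI)
    fix a b assume "a < b" "a \<in> {..<j}" "b \<in> {..<j}"
    then show "step_arc w' vs' a \<noteq> step_arc w' vs' b"
      using arcs[of a b] by (simp add: nth)
  qed auto
  moreover have "vs' ! j = vs' ! 0" "vs' ! 0 = vs ! i" "length w' = j"
    using closed ij len by (auto simp: w'_def vs'_def)
  ultimately have "(w', vs') \<in> plain_cycle_set j G" "vs' ! 0 = vs ! i"
    by (auto simp: plain_cycle_set_def)
  with j ij show ?thesis
    by (rule that)
qed

section \<open>Balls in the underlying undirected graph and the trace error\<close>

fun nbhd :: "'a pair_pre_digraph \<Rightarrow> nat \<Rightarrow> 'a set \<Rightarrow> 'a set" where
  "nbhd G 0 S = S"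
| "nbhd G (Suc n) S = nbhd G n S \<union> (\<Union>u\<in>nbhd G n S. nbrs G One u \<union> nbrs G Star u)"

lemma nbhd_mono: "m \<le> n \<Longrightarrow> nbhd G m S \<subseteq> nbhd G n S"
  by (rule lift_Suc_mono_le[of "\<lambda>n. nbhd G n S"]) auto

lemma nbhd_step:
  assumes "v \<in> nbhd G n S" "v \<in> nbrs G x u"
  shows "u \<in> nbhd G (Suc n) S"
proof -
  have "u \<in> nbrs G (flip x) v"
    using assms(2) by (rule nbrs_flip')
  then show ?thesis
    using assms(1) by (cases x) auto
qed

text \<open>The walk is traced back from vertex \<open>i\<close> to its start; each step back costs
  one unit of radius, hence the arbitrary \<open>n\<close> in the induction.\<close>

lemma walk_start_in_nbhd:
  assumes "is_walk G w vs" "i \<le> length w" "vs ! i \<in> nbhd G n S"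
  shows "vs ! 0 \<in> nbhd G (n + i) S"
  using assms(2,3)
proof (induction i arbitrary: n)
  case (Suc i)
  then have "vs ! i \<in> nbhd G (Suc n) S"
    using assms(1) by (intro nbhd_step[of "vs ! Suc i" _ _ _ "w ! i"]) (auto simp: is_walk_def)
  then show ?case
    using Suc.IH[of "Suc n"] Suc.prems by simp
qed simp

context regular_loopfree_digraph
begin

text \<open>Each vertex brings itself and at most \<open>d\<close> out-neighbours and
  \<open>d\<close> in-neighbours to the next ball.\<close>

lemma card_nbhd:
  assumes "finite S" "S \<subseteq> pverts G"
  shows "finite (nbhd G n S) \<and> nbhd G n S \<subseteq> pverts G \<and> card (nbhd G n S) \<le> (2 * d + 1) ^ n * card S"
proof (induction n)
  case (Suc n)
  let ?N = "\<lambda>u. nbrs G One u \<union> nbrs G Star u"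
  have N: "finite (?N u)" "?N u \<subseteq> pverts G" "card (?N u) \<le> 2 * d" if "u \<in> pverts G" for u
    using finite_nbrs[OF that] nbrs_verts card_Un_le[of "nbrs G One u" "nbrs G Star u"]
      card_nbrs[OF that] by auto
  have "card (\<Union>u\<in>nbhd G n S. ?N u) \<le> (\<Sum>u\<in>nbhd G n S. card (?N u))"
    using Suc by (intro card_UN_le) auto
  also have "\<dots> \<le> card (nbhd G n S) * (2 * d)"
    using sum_bounded_above[of "nbhd G n S" "\<lambda>u. card (?N u)" "2 * d"] N(3) Suc by auto
  finally have "card (nbhd G (Suc n) S) \<le> (2 * d + 1) * card (nbhd G n S)"
    using card_Un_le[of "nbhd G n S" "\<Union>u\<in>nbhd G n S. ?N u"] by (simp add: algebra_simps)
  also have "\<dots> \<le> (2 * d + 1) * ((2 * d + 1) ^ n * card S)"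
    using Suc by (intro mult_left_mono) auto
  also have "\<dots> = (2 * d + 1) ^ Suc n * card S"
    by (simp only: power_Suc mult.assoc)
  finally show ?case
    using Suc N by auto
qed (use assms in auto)

text \<open>The three factors bound the error at one vertex, the growth of a ball of radius
  \<open>length w\<close>, and the number of starting points of plain cycles of length at most
  \<open>length w\<close>.\<close>

lemma walk_count_trace_error:
  assumes "finite (pverts G)" "d \<ge> 1"
  shows "\<bar>(\<Sum>v\<in>pverts G. real (walk_count G w v v)) - real (card (pverts G)) * real (tree_count d w [])\<bar>
    \<le> real (d ^ length w) * real ((2 * d + 1) ^ length w) *
       (\<Sum>j\<in>{1..length w}. 2 * real j * plain_cycles j G)"
proof -
  define k where "k = length w"
  define C where "C = (\<Union>j\<in>{1..k}. (\<lambda>(w, vs). vs ! 0) ` plain_cycle_set j G)"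
  let ?D = "nbhd G k C"
  let ?err = "\<lambda>v. real (walk_count G w v v) - real (tree_count d w [])"
  have C: "finite C" "C \<subseteq> pverts G"
    using card_plain_cycle_set(1)[OF assms(1)]
    by (auto simp: C_def plain_cycle_set_def is_walk_def subset_iff)
  have "card C \<le> (\<Sum>j\<in>{1..k}. card ((\<lambda>(w, vs). vs ! 0) ` plain_cycle_set j G))"
    unfolding C_def by (intro card_UN_le) simp
  also have "\<dots> \<le> (\<Sum>j\<in>{1..k}. card (plain_cycle_set j G))"
    using card_plain_cycle_set(1)[OF assms(1)] by (intro sum_mono card_image_le) auto
  finally have "real (card C) \<le> real (\<Sum>j\<in>{1..k}. card (plain_cycle_set j G))"
    by (rule of_nat_mono)
  also have "\<dots> = (\<Sum>j\<in>{1..k}. 2 * real j * plain_cycles j G)"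
    unfolding of_nat_sum by (intro sum.cong card_plain_cycle_set(2)[OF assms(1)]) auto
  finally have card_C: "real (card C) \<le> (\<Sum>j\<in>{1..k}. 2 * real j * plain_cycles j G)" .
  \<comment> \<open>A closed nonbacktracking walk at \<open>v\<close> of length at most
    \<open>k\<close> would contain a plain cycle starting at its vertex \<open>i\<close>, where
    \<open>i \<le> k\<close>; tracing back puts \<open>v\<close> into the ball
    \<open>?D\<close>.\<close>
  have zero: "?err v = 0" if "v \<in> pverts G" "v \<notin> ?D" for v
  proof -
    have "hd ps \<noteq> v"
      if ps: "is_walk G ys ps" "nonbacktracking ys ps" "last ps = v" "ys \<noteq> []" "length ys \<le> k"
      for ys ps
    proof
      assume hd: "hd ps = v"
      then obtain i j w' vs' where cycle: "1 \<le> j" "i + j \<le> length ys"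
        "(w', vs') \<in> plain_cycle_set j G" "vs' ! 0 = ps ! i"
        using closed_nonbacktracking_walk_contains_plain_cycle[OF ps(1,2,4)] ps(3) by metis
      then have "ps ! i \<in> nbhd G 0 C"
        using ps(5) by (auto simp: C_def intro!: bexI[of _ j] image_eqI[of _ _ "(w', vs')"])
      then have "ps ! 0 \<in> nbhd G (0 + i) C"
        using ps(1) cycle by (intro walk_start_in_nbhd[of G ys]) auto
      then have "ps ! 0 \<in> ?D"
        using nbhd_mono[of i k G C] cycle ps(5) by auto
      moreover have "ps ! 0 = v"
        using hd ps(1) by (cases ps) (auto simp: is_walk_def)
      ultimately show False
        using \<open>v \<notin> ?D\<close> by simp
    qed
    then have "walk_count G w v v = tree_count d w []"
      by (intro walk_count_closed \<open>v \<in> pverts G\<close>) (auto simp: k_def)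
    then show ?thesis
      by simp
  qed
  have D: "finite ?D" "?D \<subseteq> pverts G" "card ?D \<le> (2 * d + 1) ^ k * card C"
    using card_nbhd[OF C] by auto
  \<comment> \<open>Both counts lie between 0 and \<open>d ^ k\<close>, so their difference costs
    \<open>d ^ k\<close> only once.\<close>
  have le: "\<bar>?err v\<bar> \<le> real (d ^ k)" if "v \<in> pverts G" for v
  proof -
    have "real (walk_count G w v v) \<le> real (d ^ k)" "real (tree_count d w []) \<le> real (d ^ k)"
      unfolding of_nat_le_iff k_def using walk_count_le[OF that] tree_count_le[OF assms(2)] by auto
    then show ?thesis
      by (simp add: abs_le_iff del: of_nat_power)
  qed
  have "\<bar>(\<Sum>v\<in>pverts G. real (walk_count G w v v)) - real (card (pverts G)) * real (tree_count d w [])\<bar>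
      = \<bar>\<Sum>v\<in>pverts G. ?err v\<bar>"
    by (simp add: sum_subtractf)
  also have "(\<Sum>v\<in>pverts G. ?err v) = (\<Sum>v\<in>?D. ?err v)"
    by (rule sum.mono_neutral_right) (use assms(1) D zero in auto)
  also have "\<bar>\<Sum>v\<in>?D. ?err v\<bar> \<le> (\<Sum>v\<in>?D. \<bar>?err v\<bar>)"
    by (rule sum_abs)
  also have "\<dots> \<le> real (card ?D) * real (d ^ k)"
    using D(2) le by (intro sum_bounded_above) auto
  also have "\<dots> \<le> real ((2 * d + 1) ^ k * card C) * real (d ^ k)"
    using D(3) by (intro mult_right_mono of_nat_mono) auto
  also have "\<dots> = real (d ^ k) * real ((2 * d + 1) ^ k) * real (card C)"
    by simp
  also have "\<dots> \<le> real (d ^ k) * real ((2 * d + 1) ^ k) * (\<Sum>j\<in>{1..k}. 2 * real j * plain_cycles j G)"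
    using card_C by (intro mult_left_mono) auto
  finally show ?thesis
    by (simp add: k_def)
qed

end

section \<open>The regular directed tree\<close>

lemma reduced_snoc:
  "reduced (v @ [x]) \<longleftrightarrow> reduced v \<and> (v = [] \<or> last v \<noteq> inv_letter x)"
proof -
  have "x = inv_letter (last v) \<longleftrightarrow> last v = inv_letter x"
    by (metis inv_letter_inv_letter)
  then show ?thesis
    unfolding reduced_def successively_append_iff by simp
qed

text \<open>Arcs of the tree multiply on the right, whereas \<open>reduce\<close> builds words by
  prepending letters; this describes right multiplication of a reduced word by one letter.\<close>

lemma reduce_snoc:
  assumes "reduced v"
  shows "reduce (v @ [x]) = (if v \<noteq> [] \<and> last v = inv_letter x then butlast v else v @ [x])"
proof (cases "v \<noteq> [] \<and> last v = inv_letter x")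
  case True
  then have v: "v = butlast v @ [inv_letter x]"
    by (metis append_butlast_last_id)
  then have "reduced (butlast v)"
    using assms reduced_snoc by metis
  have "reduce (v @ [x]) = reduce (butlast v @ [inv_letter x, x])"
    using v by (metis append.assoc append_Cons append_Nil)
  also have "\<dots> = reduce (butlast v)"
    by (simp add: reduce_append) (simp add: reduce_def)
  finally show ?thesis
    using True reduce_reduced[OF \<open>reduced (butlast v)\<close>] by simp
next
  case False
  then have "reduced (v @ [x])"
    using assms by (simp add: reduced_snoc)
  then show ?thesis
    unfolding if_not_P[OF False] by (rule reduce_reduced)
qed

lemma reduce_snoc_cancel:
  assumes "reduced v"
  shows "reduce (reduce (v @ [x]) @ [inv_letter x]) = v"
proof -
  have "reduce (reduce (v @ [x]) @ [inv_letter x]) = reduce (v @ [x, inv_letter x])"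
    by (simp add: reduce_reduce_left)
  also have "\<dots> = foldr reduced_Cons v []"
    by (simp add: reduce_append)
  finally have "reduce (reduce (v @ [x]) @ [inv_letter x]) = foldr reduced_Cons v []" .
  then show ?thesis
    using reduce_reduced[OF assms] by (simp add: reduce_def)
qed

text \<open>Cancelling shortens \<open>v\<close> and appending lengthens it, so equal results arise
  in the same way. Distinct generators therefore lead to distinct neighbours.\<close>

lemma reduce_snoc_inj:
  assumes "reduced v" "reduce (v @ [x]) = reduce (v @ [y])"
  shows "x = y"
proof -
  have "length (butlast v) \<noteq> length (v @ [z])" for z
    by simp
  then have "butlast v \<noteq> v @ [z]" for z
    by metis
  then have "inv_letter x = inv_letter y \<or> v @ [x] = v @ [y]"
    using assms(2) unfolding reduce_snoc[OF assms(1)] by metis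
  then show ?thesis
    by (metis inv_letter_inv_letter same_append_eq list.inject)
qed

section \<open>The Cayley graph in terms of reduced words\<close>

lemma pverts_regular_tree:
  "pverts (regular_tree d) = {v. set v \<subseteq> {1..d} \<times> UNIV \<and> reduced v}"
  by (simp add: regular_tree_def free_group_def)

lemma parcs_regular_tree:
  "parcs (regular_tree d) =
     {(v, reduce (v @ [(i, True)])) | v i. v \<in> pverts (regular_tree d) \<and> i \<in> {1..d}}"
  by (simp add: regular_tree_def free_group_def free_gen_def)

lemma reduce_snoc_verts:
  "v \<in> pverts (regular_tree d) \<Longrightarrow> i \<in> {1..d} \<Longrightarrow> reduce (v @ [(i, b)]) \<in> pverts (regular_tree d)"
  using set_reduce[of "v @ [(i, b)]"] by (auto simp: pverts_regular_tree reduced_reduce)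

lemma nbrs_regular_tree:
  assumes v: "v \<in> pverts (regular_tree d)"
  shows "nbrs (regular_tree d) x v = (\<lambda>i. reduce (v @ [(i, x = One)])) ` {1..d}"
proof (cases x)
  case One
  then show ?thesis
    using v by (auto simp: nbrs_def orient_def parcs_regular_tree)
next
  case Star
  \<comment> \<open>The equation saying that \<open>v\<close> is \<open>u\<close> times a generator
    is solved for \<open>u\<close> by multiplying by the inverse generator on the right.\<close>
  have "u \<in> pverts (regular_tree d) \<and> i \<in> {1..d} \<and> v = reduce (u @ [(i, True)]) \<longleftrightarrow>
      i \<in> {1..d} \<and> u = reduce (v @ [(i, False)])" for u i
    using v reduce_snoc_verts[OF v, of i False] reduce_snoc_cancel[of u "(i, True)"]
      reduce_snoc_cancel[of v "(i, False)"]
    by (auto simp: inv_letter_def pverts_regular_tree)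
  then have "nbrs (regular_tree d) x v = {u. \<exists>i. i \<in> {1..d} \<and> u = reduce (v @ [(i, False)])}"
    unfolding Star nbrs_def orient_def parcs_regular_tree by auto
  then show ?thesis
    using Star by auto
qed

lemma regular_loopfree_digraph_regular_tree: "regular_loopfree_digraph (regular_tree d) d"
proof -
  interpret pair_wf_digraph "regular_tree d"
    by (rule pair_wf_digraph_regular_tree)
  show ?thesis
  proof unfold_locales
    fix e assume "e \<in> parcs (regular_tree d)"
    then obtain v i where e: "e = (v, reduce (v @ [(i, True)]))" "reduced v"
      by (auto simp: parcs_regular_tree pverts_regular_tree)
    \<comment> \<open>Right multiplication by a generator changes the length of a reduced word,
      which excludes loops.\<close>
    have "v \<noteq> [] \<Longrightarrow> length (butlast v) < length v"
      by simp
    then have "length (snd e) \<noteq> length (fst e)"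
      using e by (auto simp: reduce_snoc simp del: length_butlast)
    then show "fst e \<noteq> snd e"
      by auto
  next
    fix u x assume u: "u \<in> pverts (regular_tree d)"
    then show "finite (nbrs (regular_tree d) x u)"
      by (simp add: nbrs_regular_tree)
    have "inj_on (\<lambda>i. reduce (u @ [(i, x = One)])) {1..d}"
      using u by (auto simp: inj_on_def pverts_regular_tree dest!: reduce_snoc_inj)
    then show "card (nbrs (regular_tree d) x u) = d"
      using u by (simp add: nbrs_regular_tree card_image)
  qed
qed

text \<open>Read backwards from the root, a nonbacktracking walk appends a letter at every step, so
  it cannot start at the root. The sign of the last letter is recorded because the induction step
  has to recognise a cancellation as a backtrack: stepping back along \<open>One\<close> appends an
  inverse generator, along \<open>Star\<close> a generator.\<close>

lemma nonbacktracking_walk_regular_tree: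
  assumes "is_walk (regular_tree d) ys ps" "nonbacktracking ys ps" "last ps = []" "ys \<noteq> []"
  shows "\<exists>i. hd ps = ps ! 1 @ [(i, hd ys = Star)]"
  using assms
proof (induction ys arbitrary: ps)
  case (Cons y ys)
  interpret regular_loopfree_digraph "regular_tree d" d
    by (rule regular_loopfree_digraph_regular_tree)
  obtain u p qs where ps: "ps = u # p # qs"
    using Cons.prems(1) by (cases ys) (auto simp: is_walk_Cons is_walk_Nil)
  have p: "p \<in> nbrs (regular_tree d) y u" "is_walk (regular_tree d) ys (p # qs)"
    using Cons.prems(1) by (auto simp: ps is_walk_Cons)
  then have "u \<in> nbrs (regular_tree d) (flip y) p" "p \<in> pverts (regular_tree d)"
    by (auto intro: nbrs_flip' nbrs_verts)
  then obtain j where u: "u = reduce (p @ [(j, y = Star)])" and red: "reduced p"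
    by (cases y) (auto simp: nbrs_regular_tree pverts_regular_tree)
  show ?case
  proof (cases ys)
    case Nil
    then have "p = []"
      using p(2) Cons.prems(3) by (auto simp: is_walk_Nil ps)
    then show ?thesis
      using u by (auto simp: ps)
  next
    case (Cons y' ys')
    then have "\<exists>i. p = (p # qs) ! 1 @ [(i, y' = Star)]"
      using Cons.IH[OF p(2)] Cons.prems(2,3) nonbacktracking_Cons[of y ys u "p # qs"]
      by (auto simp: ps)
    then obtain q i where q: "q = qs ! 0" "p = q @ [(i, y' = Star)]"
      by auto
    \<comment> \<open>If the new letter cancelled the last letter of \<open>p\<close>, the walk
      would go from \<open>u\<close> to \<open>p\<close> and back to \<open>q = u\<close> along the
      same arc.\<close>
    have "(i, y' = Star) \<noteq> inv_letter (j, y = Star)"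
    proof
      assume inv: "(i, y' = Star) = inv_letter (j, y = Star)"
      then have "u = q"
        using u unfolding reduce_snoc[OF red] by (simp add: q(2))
      moreover have "y' = flip y"
        using inv by (cases y; cases y') (auto simp: inv_letter_def)
      ultimately show False
        using Cons.prems(2) q(1) by (simp add: ps Cons nonbacktracking_Cons2 orient_flip)
    qed
    then show ?thesis
      using u unfolding reduce_snoc[OF red] by (auto simp: ps q(2))
  qed
qed simp

lemma star_moment_eq_tree_count: "star_moment d w = real (tree_count d w [])"
proof -
  interpret regular_loopfree_digraph "regular_tree d" d
    by (rule regular_loopfree_digraph_regular_tree)
  have root: "[] \<in> pverts (regular_tree d)"
    by (simp add: pverts_regular_tree)
  have "star_moment d w = real (walk_count (regular_tree d) w [] [])"
    using word_entry_eq_walk_count[OF root] by (simp add: star_moment_def free_group_def)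
  moreover have "walk_count (regular_tree d) w [] [] = tree_count d w []"
    \<comment> \<open>A nonempty nonbacktracking walk that ends at the root starts at a nonempty
      word.\<close>
    by (rule walk_count_closed[OF root]) (auto dest!: nonbacktracking_walk_regular_tree)
  ultimately show ?thesis
    by simp
qed

section \<open>Convergence of star moments\<close>

lemma regular_loopfree_digraphI:
  assumes "pair_digraph G" "regular_digraph d G"
  shows "regular_loopfree_digraph G d"
proof -
  interpret pair_digraph G by fact
  show ?thesis
  proof unfold_locales
    fix u x assume u: "u \<in> pverts G"
    have sub: "nbrs G x u \<subseteq> pverts G"
      by (cases x) (auto simp: nbrs_def orient_def dest: in_arcsD1 in_arcsD2)
    then show "finite (nbrs G x u)"
      using pair_finite_verts by (rule finite_subset)
    \<comment> \<open>Arcs are pairs of vertices, so degrees, which count arcs, also count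
      neighbours.\<close>
    have "in_arcs (with_proj G) u = (\<lambda>v. (v, u)) ` nbrs G Star u"
      "out_arcs (with_proj G) u = (\<lambda>v. (u, v)) ` nbrs G One u"
      by (auto simp: in_arcs_def out_arcs_def nbrs_def orient_def)
    then have "in_degree (with_proj G) u = card (nbrs G Star u)"
      "out_degree (with_proj G) u = card (nbrs G One u)"
      by (simp_all add: in_degree_def out_degree_def card_image inj_on_def)
    then show "card (nbrs G x u) = d"
      using assms(2) u by (cases x) (auto simp: regular_digraph_def)
  qed
qed

theorem theorem2:
  fixes d k :: nat
    and G :: "nat \<Rightarrow> 'a pair_pre_digraph"
  assumes "d \<ge> 2"
    and "\<And>n. n \<ge> 1 \<Longrightarrow> pair_digraph (G n)"
    and "\<And>n. n \<ge> 1 \<Longrightarrow> pverts (G n) \<noteq> {}"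
    and "\<And>n. n \<ge> 1 \<Longrightarrow> regular_digraph d (G n)"
    and "k \<ge> 1"
    and "\<And>j. j \<in> {1..k} \<Longrightarrow>
           (\<lambda>n. plain_cycles j (G n) / real (card (pverts (G n)))) \<longlonglongrightarrow> 0"
  shows "\<forall>w. length w = k \<longrightarrow>
           (\<lambda>n. 1 / real (card (pverts (G n))) *
                  trace_on (pverts (G n)) (mat_word (pverts (G n)) (adj_matrix (G n)) w))
             \<longlonglongrightarrow> star_moment d w"
proof (intro allI impI)
  fix w :: "star_letter list" assume w: "length w = k"
  let ?N = "\<lambda>n. real (card (pverts (G n)))"
  let ?T = "\<lambda>n. trace_on (pverts (G n)) (mat_word (pverts (G n)) (adj_matrix (G n)) w)"
  let ?c = "real (d ^ k) * real ((2 * d + 1) ^ k)"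
  let ?bound = "\<lambda>n. ?c * (\<Sum>j\<in>{1..k}. 2 * real j * (plain_cycles j (G n) / ?N n))"
  \<comment> \<open>The trace error is divided by the number of vertices. As \<open>?c\<close> is
    independent of \<open>n\<close>, the bound is a fixed linear combination of sequences tending to
    0.\<close>
  have "norm (1 / ?N n * ?T n - star_moment d w) \<le> ?bound n" if n: "n \<ge> 1" for n
  proof -
    interpret G: pair_digraph "G n"
      by (rule assms(2)[OF n])
    interpret regular_loopfree_digraph "G n" d
      by (rule regular_loopfree_digraphI[OF assms(2,4)[OF n]])
    have N: "?N n > 0"
      using G.pair_finite_verts assms(3)[OF n] by (simp add: card_gt_0_iff)
    have "?T n = (\<Sum>v\<in>pverts (G n). real (walk_count (G n) w v v))"
      unfolding trace_on_def using G.pair_finite_verts by (intro sum.cong mat_word_eq_walk_count) auto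
    then have "\<bar>?T n - ?N n * star_moment d w\<bar> \<le> ?c * (\<Sum>j\<in>{1..k}. 2 * real j * plain_cycles j (G n))"
      using walk_count_trace_error[OF G.pair_finite_verts, of w] assms(1) w
      by (simp add: star_moment_eq_tree_count)
    then have "\<bar>?T n - ?N n * star_moment d w\<bar> / ?N n
        \<le> ?c * (\<Sum>j\<in>{1..k}. 2 * real j * plain_cycles j (G n)) / ?N n"
      using N by (intro divide_right_mono) auto
    also have "\<dots> = ?bound n"
      by (simp flip: sum_divide_distrib)
    also have "\<bar>?T n - ?N n * star_moment d w\<bar> / ?N n = \<bar>(?T n - ?N n * star_moment d w) / ?N n\<bar>"
      by simp
    also have "(?T n - ?N n * star_moment d w) / ?N n = 1 / ?N n * ?T n - star_moment d w"
      using assms(3)[OF n] N by (simp add: diff_divide_distrib)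
    finally show ?thesis
      by simp
  qed
  then have "eventually (\<lambda>n. norm (1 / ?N n * ?T n - star_moment d w) \<le> ?bound n) sequentially"
    by (rule eventually_sequentiallyI)
  moreover have "?bound \<longlonglongrightarrow> ?c * (\<Sum>j\<in>{1..k}. 2 * real j * 0)"
    by (intro tendsto_mult tendsto_sum tendsto_const assms(6))
  then have "?bound \<longlonglongrightarrow> 0"
    by simp
  ultimately have "(\<lambda>n. 1 / ?N n * ?T n - star_moment d w) \<longlonglongrightarrow> 0"
    by (rule Lim_null_comparison)
  then show "(\<lambda>n. 1 / ?N n * ?T n) \<longlonglongrightarrow> star_moment d w"
    by (simp add: LIM_zero_iff)
qed

end
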